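(* Assume that $\mathbb{S}(I)$ contains the identity map $\mathrm{id}_I$, and let $f\in T_{\mathbb{S}(I)}(X,\mathcal{P})$. Then $f$ is a unit-regular element of $T_{\mathbb{S}(I)}(X,\mathcal{P})$ if and only if there exists $\alpha\in U(\mathbb{S}(I))$ such that: (i) $\chi^{(f)}\alpha\chi^{(f)}=\chi^{(f)}$; (ii) $X_i\cap Xf\subseteq X_{i\alpha}f$ for all $i\in I\chi^{(f)}$; (iii) $|X_i|=|X_{i\alpha}|$ for all $i\in I$; and (iv) $\mathrm{c}(f_{\upharpoonright X_{i\alpha}})=\mathrm{d}(f_{\upharpoonright X_{i\alpha}})$ for all $i\in I\chi^{(f)}$.
   Context: $X$ is a nonempty set (possibly infinite) and $\mathcal{P}=\{X_i : i\in I\}$ is a partition of $X$ into nonempty blocks, with $X_i\cap X_j=\varnothing$ for $i\neq j$. $T(Z)$ denotes the semigroup of all maps $Z\to Z$ under composition. Maps are written on the right and composed from left to right: $x(fg)=(xf)g$; $Af=\{af: a\in A\}$. $T(X,\mathcal{P})$ is the subsemigroup of all $f\in T(X)$ such that for every $i\in I$ there is $j\in I$ with $X_if\subseteq X_j$. For $f\in T(X,\mathcal{P})$ the character $\chi^{(f)}\in T(I)$ is defined by $i\chi^{(f)}=j$ whenever $X_if\subseteq X_j$. For a subsemigroup $\mathbb{S}(I)$ of $T(I)$, $T_{\mathbb{S}(I)}(X,\mathcal{P})=\{f\in T(X,\mathcal{P}): \chi^{(f)}\in \mathbb{S}(I)\}$, a subsemigroup of $T(X,\mathcal{P})$; it contains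 $\mathrm{id}_X$ iff $\mathrm{id}_I\in\mathbb{S}(I)$. For a semigroup $S$ with identity, $U(S)$ is its group of units, and $a\in S$ is unit-regular in $S$ if there is $u\in U(S)$ with $aua=a$. For a map $h\colon Y\to Z$: $\mathrm{d}(h)=|Z\setminus Yh|$, and $\mathrm{c}(h)=|Y\setminus T_h|$ where $T_h$ is a transversal of the equivalence relation $\ker(h)=\{(a,b)\in Y\times Y: ah=bh\}$, i.e. a subset of $Y$ containing exactly one element of each $\ker(h)$-class (the cardinal $\mathrm{c}(h)$ does not depend on the choice of $T_h$). For $j\in I$, $f_{\upharpoonright X_j}$ denotes the restriction of $f$ to $X_j$ regarded as a map between blocks $X_j\to X_{j\chi^{(f)}}$ (so the codomain used in $\mathrm{d}(f_{\upharpoonright X_j})$ is the block $X_{j\chi^{(f)}}$). *)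

theory Defs
  imports "HOL-Algebra.Group" "HOL-Library.Disjoint_Sets"
begin

unbundle cardinal_syntax

text \<open>
  The underlying set \<open>X\<close> and the index set \<open>I\<close> are the universes of the types \<open>'a\<close> and \<open>'i\<close>.
  Maps are ordinary functions, so the right-action product \<open>fg\<close> (first \<open>f\<close>, then \<open>g\<close>) is
  \<open>g \<circ> f\<close>.
\<close>

definition transf_monoid :: "('z \<Rightarrow> 'z) set \<Rightarrow> ('z \<Rightarrow> 'z) monoid" where
  "transf_monoid A = \<lparr>carrier = A, mult = (\<lambda>f g. g \<circ> f), one = id\<rparr>"

definition subsemigroup :: "'m set \<Rightarrow> ('m, 'k) monoid_scheme \<Rightarrow> bool" where
  "subsemigroup S G \<longleftrightarrow> S \<subseteq> carrier G \<and> (\<forall>a\<in>S. \<forall>b\<in>S. a \<otimes>\<^bsub>G\<^esub> b \<in> S)"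

definition unit_regular :: "('m, 'k) monoid_scheme \<Rightarrow> 'm \<Rightarrow> bool" where
  "unit_regular G a \<longleftrightarrow> (\<exists>u\<in>Units G. a \<otimes>\<^bsub>G\<^esub> u \<otimes>\<^bsub>G\<^esub> a = a)"

definition block_partition :: "('i \<Rightarrow> 'a set) \<Rightarrow> bool" where
  "block_partition P \<longleftrightarrow> disjoint_family P \<and> (\<forall>i. P i \<noteq> {}) \<and> (\<Union>i. P i) = UNIV"

definition preserving_maps :: "('i \<Rightarrow> 'a set) \<Rightarrow> ('a \<Rightarrow> 'a) set" where
  "preserving_maps P = {f. \<forall>i. \<exists>j. f ` P i \<subseteq> P j}"

definition character :: "('i \<Rightarrow> 'a set) \<Rightarrow> ('a \<Rightarrow> 'a) \<Rightarrow> 'i \<Rightarrow> 'i" where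
  "character P f i = (THE j. f ` P i \<subseteq> P j)"

definition T_monoid :: "('i \<Rightarrow> 'i) set \<Rightarrow> ('i \<Rightarrow> 'a set) \<Rightarrow> ('a \<Rightarrow> 'a) monoid" where
  "T_monoid S P = transf_monoid {f \<in> preserving_maps P. character P f \<in> S}"

definition kernel_on :: "'y set \<Rightarrow> ('y \<Rightarrow> 'z) \<Rightarrow> ('y \<times> 'y) set" where
  "kernel_on Y h = {(a, b) \<in> Y \<times> Y. h a = h b}"

definition transversal :: "'y set \<Rightarrow> ('y \<Rightarrow> 'z) \<Rightarrow> 'y set \<Rightarrow> bool" where
  "transversal Y h T \<longleftrightarrow> T \<subseteq> Y \<and> (\<forall>C \<in> Y // kernel_on Y h. \<exists>!t. t \<in> T \<inter> C)"

text \<open>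
  \<open>collapse Y h\<close> and \<open>defect Y Z h\<close> are the cardinals \<open>c\<close> and \<open>d\<close> of the restriction of \<open>h\<close>
  to a map \<open>Y \<rightarrow> Z\<close>. As cardinals they are only meaningful up to \<open>=o\<close>; the choice of transversal
  in \<open>collapse\<close> is immaterial by \<open>collapse_eq\<close> below.
\<close>

definition collapse :: "'y set \<Rightarrow> ('y \<Rightarrow> 'z) \<Rightarrow> 'y rel" where
  "collapse Y h = |Y - (SOME T. transversal Y h T)|"

definition defect :: "'y set \<Rightarrow> 'z set \<Rightarrow> ('y \<Rightarrow> 'z) \<Rightarrow> 'z rel" where
  "defect Y Z h = |Z - h ` Y|"

lemma transversal_iff:
  "transversal Y h T \<longleftrightarrow> T \<subseteq> Y \<and> (\<forall>y\<in>Y. \<exists>!t. t \<in> T \<and> h t = h y)"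
proof -
  have "kernel_on Y h `` {y} = {z \<in> Y. h z = h y}" if "y \<in> Y" for y
    using that by (auto simp: kernel_on_def)
  then have "Y // kernel_on Y h = (\<lambda>y. {z \<in> Y. h z = h y}) ` Y"
    unfolding quotient_def by auto
  then have "transversal Y h T \<longleftrightarrow>
      T \<subseteq> Y \<and> (\<forall>y\<in>Y. \<exists>!t. t \<in> T \<inter> {z \<in> Y. h z = h y})"
    unfolding transversal_def by simp
  also have "\<dots> \<longleftrightarrow> T \<subseteq> Y \<and> (\<forall>y\<in>Y. \<exists>!t. t \<in> T \<and> h t = h y)"
  proof (intro conj_cong ball_cong refl)
    fix y assume "T \<subseteq> Y"
    then have "t \<in> T \<inter> {z \<in> Y. h z = h y} \<longleftrightarrow> t \<in> T \<and> h t = h y" for t by auto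
    then show "(\<exists>!t. t \<in> T \<inter> {z \<in> Y. h z = h y}) \<longleftrightarrow> (\<exists>!t. t \<in> T \<and> h t = h y)" by simp
  qed
  finally show ?thesis .
qed

lemma transversal_exists: "\<exists>T. transversal Y h T"
proof
  show "transversal Y h (inv_into Y h ` h ` Y)"
    unfolding transversal_iff
  proof (intro conjI ballI ex1I)
    show "inv_into Y h ` h ` Y \<subseteq> Y"
      by (auto intro: inv_into_into)
    fix y assume "y \<in> Y"
    then show "inv_into Y h (h y) \<in> inv_into Y h ` h ` Y" "h (inv_into Y h (h y)) = h y"
      by (auto simp: f_inv_into_f)
    fix t assume "t \<in> inv_into Y h ` h ` Y \<and> h t = h y"
    then show "t = inv_into Y h (h y)"
      by (auto simp: f_inv_into_f)
  qed
qed

lemma transversal_card_le: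
  assumes T: "transversal Y h T" and T': "transversal Y h T'"
  shows "|Y - T| \<le>o |Y - T'|"
proof -
  define r where "r y = (THE t. t \<in> T \<and> h t = h y)" for y
  have r: "r y \<in> T \<and> h (r y) = h y" if "y \<in> Y" for y
    unfolding r_def by (rule theI') (use T that in \<open>simp add: transversal_iff\<close>)
  have TY: "T \<subseteq> Y" and TY': "T' \<subseteq> Y" using T T' by (simp_all add: transversal_iff)
  have u: "s = t" if "s \<in> T'" "t \<in> T'" "h s = h t" for s t
  proof -
    have "\<exists>!z. z \<in> T' \<and> h z = h t"
      using T' TY' that(2) by (auto simp: transversal_iff)
    with that show ?thesis by blast
  qed
  let ?g = "\<lambda>y. if y \<in> T' then r y else y"
  have "inj_on ?g (Y - T)"
  proof (rule inj_onI)
    fix x y assume xy: "x \<in> Y - T" "y \<in> Y - T" and eq: "?g x = ?g y"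
    have *: "r x \<in> T" "r y \<in> T" "h (r x) = h x" "h (r y) = h y" using r xy by auto
    show "x = y"
    proof (cases "x \<in> T'"; cases "y \<in> T'")
      assume "x \<in> T'" "y \<in> T'"
      then show ?thesis using eq * u[of x y] by simp
    qed (use eq * xy in auto)
  qed
  moreover have "?g y \<in> Y - T'" if y: "y \<in> Y - T" for y
  proof (cases "y \<in> T'")
    case True
    have *: "r y \<in> T" "h (r y) = h y" using r y by auto
    have "r y \<notin> T'" using u[OF _ True *(2)] *(1) y by auto
    then show ?thesis using True * TY by auto
  qed (use y in simp)
  then have "?g ` (Y - T) \<subseteq> Y - T'" by blast
  ultimately show ?thesis
    using card_of_ordLeq[of "Y - T" "Y - T'"] by blast
qed

lemma collapse_eq:
  assumes "transversal Y h T"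
  shows "collapse Y h =o |Y - T|"
  unfolding collapse_def using assms someI_ex[OF transversal_exists[of Y h]]
  by (simp add: ordIso_iff_ordLeq transversal_card_le)

lemma character_eq_iff:
  assumes P: "block_partition P" and f: "f \<in> preserving_maps P"
  shows "character P f i = j \<longleftrightarrow> f ` P i \<subseteq> P j"
proof -
  have uniq: "j = k" if "f ` P i \<subseteq> P j" "f ` P i \<subseteq> P k" for j k
  proof (rule ccontr)
    assume "j \<noteq> k"
    then have "P j \<inter> P k = {}"
      using P by (simp add: block_partition_def disjoint_family_on_def)
    moreover obtain x where "x \<in> P i" using P unfolding block_partition_def by blast
    then have "f x \<in> P j" "f x \<in> P k" using that by auto
    ultimately show False by blast
  qed
  obtain k where k: "f ` P i \<subseteq> P k" using f by (auto simp: preserving_maps_def)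
  have c: "character P f i = k"
    unfolding character_def
  proof (rule the_equality)
    show "f ` P i \<subseteq> P k" by (rule k)
    show "l = k" if "f ` P i \<subseteq> P l" for l by (rule uniq[OF that k])
  qed
  show ?thesis
  proof
    show "f ` P i \<subseteq> P j" if "character P f i = j" using that c k by simp
    show "character P f i = j" if "f ` P i \<subseteq> P j" using c uniq[OF k that] by simp
  qed
qed

lemma character_id:
  assumes "block_partition P"
  shows "id \<in> preserving_maps P" "character P id = id"
proof -
  show *: "id \<in> preserving_maps P" by (auto simp: preserving_maps_def)
  show "character P id = id"
  proof
    show "character P id i = id i" for i
      using character_eq_iff[OF assms *] by simp
  qed
qed

lemma character_comp:
  assumes P: "block_partition P" and f: "f \<in> preserving_maps P" and g: "g \<in> preserving_maps P"
  shows "g \<circ> f \<in> preserving_maps P" "character P (g \<circ> f) = character P g \<circ> character P f"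
proof -
  have *: "(g \<circ> f) ` P i \<subseteq> P (character P g (character P f i))" for i
  proof -
    have "f ` P i \<subseteq> P (character P f i)"
      using character_eq_iff[OF P f] by blast
    moreover have "g ` P (character P f i) \<subseteq> P (character P g (character P f i))"
      using character_eq_iff[OF P g] by blast
    ultimately show ?thesis by auto
  qed
  show gf: "g \<circ> f \<in> preserving_maps P"
    unfolding preserving_maps_def using * by blast
  show "character P (g \<circ> f) = character P g \<circ> character P f"
  proof
    fix i
    show "character P (g \<circ> f) i = (character P g \<circ> character P f) i"
      using * character_eq_iff[OF P gf] by (simp only: o_apply)
  qed
qed

lemma T_monoid_monoid:
  assumes "block_partition P" "subsemigroup S (transf_monoid UNIV)" "id \<in> S"
  shows "monoid (T_monoid S P)"
proof -
  have S: "b \<circ> a \<in> S" if "a \<in> S" "b \<in> S" for a b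
    using assms(2) that by (simp add: subsemigroup_def transf_monoid_def)
  show ?thesis
    by (rule monoidI)
      (use assms(1,3) S in \<open>simp_all add: T_monoid_def transf_monoid_def character_id
        character_comp comp_assoc\<close>)
qed

end

theory Submission imports Defs begin

text \<open>
  Unit-regularity of \<open>f\<close> asks for a unit \<open>u\<close> with \<open>f \<circ> u \<circ> f = f\<close>. A unit is the same thing as a
  map that sends every block \<open>P i\<close> bijectively onto \<open>P (\<alpha> i)\<close> for some unit \<open>\<alpha>\<close> of \<open>S\<close>, which is
  then its character (lemma \<open>Units_T_monoid_iff\<close>). Once \<open>\<alpha>\<close> is chosen, the bijections on the
  individual blocks can be picked independently of each other, so the problem becomes local.

  Comparing characters gives (i), which says that \<open>f\<close> maps \<open>P (\<alpha> i)\<close> back into \<open>P i\<close> for every \<open>i\<close>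
  in the image of the character. On such a block \<open>P i\<close>, the identity \<open>f \<circ> u \<circ> f = f\<close> says that
  \<open>f (u y) = y\<close> for every point \<open>y\<close> of \<open>P i\<close> in the image of \<open>f\<close>. Since \<open>u y\<close> lies in \<open>P (\<alpha> i)\<close>,
  all these points must already be hit from \<open>P (\<alpha> i)\<close>, which is (ii), and \<open>u\<close> is then a bijection
  \<open>P i \<rightarrow> P (\<alpha> i)\<close> that is a section of \<open>f\<close> over \<open>f ` P (\<alpha> i)\<close>. The image of a section is a
  transversal of the kernel, and extending the section to a bijection amounts to matching the
  points missed by \<open>f\<close> with the points outside the transversal; this is possible exactly when
  defect and collapse agree (lemma \<open>collapse_eq_defect_iff\<close>), which is (iv). On the blocks that \<open>f\<close>
  does not meet, \<open>u\<close> is only required to be a bijection, and this is where (iii) enters.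
\<close>

section \<open>Bijective extensions of sections\<close>

lemma transversal_section_image:
  assumes "s ` f ` Y \<subseteq> Y" and "\<And>z. z \<in> f ` Y \<Longrightarrow> f (s z) = z"
  shows "transversal Y f (s ` f ` Y)"
  unfolding transversal_iff
proof (intro conjI ballI ex1I)
  show "s ` f ` Y \<subseteq> Y" by (rule assms)
  fix y assume y: "y \<in> Y"
  show "s (f y) \<in> s ` f ` Y" "f (s (f y)) = f y" using y assms(2) by auto
  fix t assume "t \<in> s ` f ` Y \<and> f t = f y"
  then show "t = s (f y)" using assms(2) by auto
qed

text \<open>
  A section of \<open>f\<close> already identifies the image of \<open>f\<close> with a transversal, so a bijection
  extending it is the same as a bijection between the two complements, whose sizes are the defect
  and the collapse. For infinite sets this is a genuine condition, even when \<open>Y\<close> and \<open>Z\<close> are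
  equipotent.
\<close>

lemma collapse_eq_defect_iff:
  assumes fY: "f ` Y \<subseteq> Z"
  shows "collapse Y f =o defect Y Z f \<longleftrightarrow> (\<exists>g. bij_betw g Z Y \<and> (\<forall>z\<in>f ` Y. f (g z) = z))"
proof
  assume eq: "collapse Y f =o defect Y Z f"
  define s where "s = inv_into Y f"
  have sec: "f (s z) = z" if "z \<in> f ` Y" for z
    using that by (simp add: s_def f_inv_into_f)
  have sub: "s ` f ` Y \<subseteq> Y"
    by (auto simp: s_def intro: inv_into_into)
  have "|Y - s ` f ` Y| =o collapse Y f"
    by (rule ordIso_symmetric[OF collapse_eq[OF transversal_section_image[OF sub sec]]])
  then have "|Z - f ` Y| =o |Y - s ` f ` Y|"
    using eq unfolding defect_def by (meson ordIso_symmetric ordIso_transitive)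
  then obtain h where h: "bij_betw h (Z - f ` Y) (Y - s ` f ` Y)"
    using card_of_ordIso by blast
  define g where "g z = (if z \<in> f ` Y then s z else h z)" for z
  have "inj_on s (f ` Y)"
    using sec by (rule inj_on_inverseI)
  then have "bij_betw g (f ` Y) (s ` f ` Y)"
    by (simp add: bij_betw_def g_def inj_on_def)
  moreover have "bij_betw g (Z - f ` Y) (Y - s ` f ` Y)"
    using h by (rule bij_betw_cong[THEN iffD1, rotated]) (simp add: g_def)
  ultimately have "bij_betw g (f ` Y \<union> (Z - f ` Y)) (s ` f ` Y \<union> (Y - s ` f ` Y))"
    by (rule bij_betw_combine) blast
  then have "bij_betw g Z Y"
    using fY sub by (simp add: Un_absorb1)
  moreover have "\<forall>z\<in>f ` Y. f (g z) = z"
    using sec by (simp add: g_def)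
  ultimately show "\<exists>g. bij_betw g Z Y \<and> (\<forall>z\<in>f ` Y. f (g z) = z)" by blast
next
  assume "\<exists>g. bij_betw g Z Y \<and> (\<forall>z\<in>f ` Y. f (g z) = z)"
  then obtain g where g: "bij_betw g Z Y" and sec: "\<And>z. z \<in> f ` Y \<Longrightarrow> f (g z) = z" by blast
  have inj: "inj_on g Z" and im: "g ` Z = Y"
    using g by (simp_all add: bij_betw_def)
  have sub: "g ` f ` Y \<subseteq> Y"
    using im fY by blast
  have "g ` (Z - f ` Y) = Y - g ` f ` Y"
    using inj_on_image_set_diff[OF inj Diff_subset fY] im by simp
  then have "bij_betw g (Z - f ` Y) (Y - g ` f ` Y)"
    using inj_on_subset[OF inj Diff_subset] by (simp add: bij_betw_def)
  then have "|Z - f ` Y| =o |Y - g ` f ` Y|"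
    using card_of_ordIso by blast
  then show "collapse Y f =o defect Y Z f"
    using collapse_eq[OF transversal_section_image[OF sub sec]]
    unfolding defect_def by (meson ordIso_symmetric ordIso_transitive)
qed

section \<open>Units of the monoids of transformations\<close>

lemma block_unique:
  assumes "block_partition P" "x \<in> P i" "x \<in> P j"
  shows "i = j"
  using assms by (auto simp: block_partition_def disjoint_family_on_def)

lemma Units_transf_monoid_iff:
  "a \<in> Units (transf_monoid A) \<longleftrightarrow> a \<in> A \<and> (\<exists>b\<in>A. b \<circ> a = id \<and> a \<circ> b = id)"
  by (auto simp: Units_def transf_monoid_def)

text \<open>
  The inverse of a unit has the inverse character, so it maps \<open>P (\<alpha> i)\<close> back into \<open>P i\<close>; hence units
  are bijective block by block. Conversely, bijections between blocks glue to a bijection because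
  \<open>\<alpha>\<close> permutes the blocks. That \<open>\<alpha>\<close> is invertible inside \<open>S\<close>, not only as a map, is what puts the
  inverse of the glued map into the monoid.
\<close>

lemma Units_T_monoid_iff:
  assumes P: "block_partition P"
  shows "u \<in> Units (T_monoid S P) \<longleftrightarrow>
    (\<exists>\<alpha> \<in> Units (transf_monoid S). \<forall>i. bij_betw u (P i) (P (\<alpha> i)))"
proof
  assume "u \<in> Units (T_monoid S P)"
  then obtain v where u: "u \<in> preserving_maps P" "character P u \<in> S"
    and v: "v \<in> preserving_maps P" "character P v \<in> S"
    and inv: "v \<circ> u = id" "u \<circ> v = id"
    unfolding T_monoid_def Units_transf_monoid_iff by auto
  have char_inv: "character P v \<circ> character P u = id" "character P u \<circ> character P v = id"
    using character_comp(2)[OF P u(1) v(1)] character_comp(2)[OF P v(1) u(1)]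
      inv character_id(2)[OF P] by simp_all
  have "bij_betw u (P i) (P (character P u i))" for i
  proof (rule bij_betw_byWitness[where f' = v])
    show "\<forall>x\<in>P i. v (u x) = x" "\<forall>y\<in>P (character P u i). u (v y) = y"
      using inv by (simp_all add: pointfree_idE)
    show "u ` P i \<subseteq> P (character P u i)"
      using character_eq_iff[OF P u(1)] by blast
    have "character P v (character P u i) = i"
      using char_inv(1) by (rule pointfree_idE)
    then show "v ` P (character P u i) \<subseteq> P i"
      using character_eq_iff[OF P v(1)] by blast
  qed
  moreover have "character P u \<in> Units (transf_monoid S)"
    unfolding Units_transf_monoid_iff using u v char_inv by blast
  ultimately show "\<exists>\<alpha> \<in> Units (transf_monoid S). \<forall>i. bij_betw u (P i) (P (\<alpha> i))" by blast
next
  assume "\<exists>\<alpha> \<in> Units (transf_monoid S). \<forall>i. bij_betw u (P i) (P (\<alpha> i))"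
  then obtain \<alpha> \<beta> where S: "\<alpha> \<in> S" "\<beta> \<in> S" and inv: "\<beta> \<circ> \<alpha> = id" "\<alpha> \<circ> \<beta> = id"
    and u: "\<And>i. bij_betw u (P i) (P (\<alpha> i))"
    unfolding Bex_def Units_transf_monoid_iff by blast
  have \<beta>\<alpha>: "\<beta> (\<alpha> i) = i" and \<alpha>\<beta>: "\<alpha> (\<beta> i) = i" for i
    using inv by (simp_all add: pointfree_idE)
  have cover: "\<exists>i. x \<in> P i" for x
    using P by (auto simp: block_partition_def)
  have u_im: "u ` P i = P (\<alpha> i)" for i
    using u by (simp add: bij_betw_def)
  have "inj u"
  proof (rule injI)
    fix x y assume eq: "u x = u y"
    obtain i j where ij: "x \<in> P i" "y \<in> P j" using cover by blast
    then have "u x \<in> P (\<alpha> i)" "u x \<in> P (\<alpha> j)"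
      using u_im eq by (metis imageI)+
    then have "\<alpha> i = \<alpha> j" by (rule block_unique[OF P])
    then have "i = j" using \<beta>\<alpha> by metis
    then show "x = y"
      using ij eq u[of i] by (auto simp: bij_betw_def inj_on_def)
  qed
  moreover have "surj u"
  proof -
    have "y \<in> range u" for y
    proof -
      obtain i where "y \<in> P i" using cover by blast
      then have "y \<in> u ` P (\<beta> i)" using u_im \<alpha>\<beta> by simp
      then show ?thesis by blast
    qed
    then show ?thesis by blast
  qed
  ultimately have uv: "inv_into UNIV u \<circ> u = id" "u \<circ> inv_into UNIV u = id"
    by (simp_all add: surj_iff)
  have v_im: "inv_into UNIV u ` P i \<subseteq> P (\<beta> i)" for i
  proof -
    have "P i = u ` P (\<beta> i)" using u_im \<alpha>\<beta> by simp
    then show ?thesis using \<open>inj u\<close> by (simp add: image_inv_f_f)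
  qed
  have u_pres: "u \<in> preserving_maps P" and v_pres: "inv_into UNIV u \<in> preserving_maps P"
    using u_im v_im unfolding preserving_maps_def by blast+
  have "character P u = \<alpha>" "character P (inv_into UNIV u) = \<beta>"
    using u_im v_im by (auto simp: fun_eq_iff character_eq_iff[OF P] u_pres v_pres)
  then show "u \<in> Units (T_monoid S P)"
    unfolding T_monoid_def Units_transf_monoid_iff
    using u_pres v_pres S uv by blast
qed

section \<open>Unit-regular elements\<close>

theorem theorem4p4:
  fixes P :: "'i \<Rightarrow> 'a set" and S :: "('i \<Rightarrow> 'i) set" and f :: "'a \<Rightarrow> 'a"
  assumes "block_partition P"
    and "subsemigroup S (transf_monoid UNIV)"
    and "id \<in> S"
    and "f \<in> carrier (T_monoid S P)"
  shows "unit_regular (T_monoid S P) f \<longleftrightarrow>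
    (\<exists>\<alpha> \<in> Units (transf_monoid S).
        character P f \<circ> \<alpha> \<circ> character P f = character P f \<and>
        (\<forall>i \<in> range (character P f). P i \<inter> range f \<subseteq> f ` P (\<alpha> i)) \<and>
        (\<forall>i. |P i| =o |P (\<alpha> i)| ) \<and>
        (\<forall>i \<in> range (character P f).
            collapse (P (\<alpha> i)) f =o defect (P (\<alpha> i)) (P (character P f (\<alpha> i))) f))"
proof -
  note P = assms(1)
  let ?\<chi> = "character P f"
  have f: "f \<in> preserving_maps P"
    using assms(4) by (simp add: T_monoid_def transf_monoid_def)
  have f_im: "f ` P i \<subseteq> P (?\<chi> i)" for i
    using character_eq_iff[OF P f] by blast
  have cover: "\<exists>i. x \<in> P i" for x
    using P by (auto simp: block_partition_def)
  \<comment> \<open>Both sides now ask for the same \<open>\<alpha>\<close>, so the remaining equivalence is proved for \<open>\<alpha>\<close> fixed.\<close>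
  have regular_iff: "unit_regular (T_monoid S P) f \<longleftrightarrow>
      (\<exists>\<alpha> \<in> Units (transf_monoid S). \<exists>u. (\<forall>i. bij_betw u (P i) (P (\<alpha> i))) \<and> f \<circ> u \<circ> f = f)"
    unfolding unit_regular_def Bex_def Units_T_monoid_iff[OF P]
    by (auto simp: T_monoid_def transf_monoid_def comp_assoc)
  show ?thesis
    unfolding regular_iff
  proof (intro bex_cong refl iffI)
    fix \<alpha>
    assume "\<exists>u. (\<forall>i. bij_betw u (P i) (P (\<alpha> i))) \<and> f \<circ> u \<circ> f = f"
    then obtain u where u: "\<And>i. bij_betw u (P i) (P (\<alpha> i))" and "f \<circ> u \<circ> f = f"
      by blast
    then have fuf: "f (u (f x)) = f x" for x
      by (simp add: fun_eq_iff)
    have u_im: "u ` P i = P (\<alpha> i)" for i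
      using u by (simp add: bij_betw_def)
    have \<chi>\<alpha>\<chi>: "?\<chi> (\<alpha> (?\<chi> i)) = ?\<chi> i" for i
    proof -
      obtain x where "x \<in> P i" using P unfolding block_partition_def by blast
      then have fx: "f x \<in> P (?\<chi> i)" using f_im by blast
      then have "u (f x) \<in> P (\<alpha> (?\<chi> i))" using u_im by blast
      then have "f x \<in> P (?\<chi> (\<alpha> (?\<chi> i)))" using f_im fuf by (metis image_subset_iff)
      then show ?thesis using fx by (rule block_unique[OF P])
    qed
    have "P i \<inter> range f \<subseteq> f ` P (\<alpha> i)" for i
    proof
      fix y assume y: "y \<in> P i \<inter> range f"
      then have "f (u y) = y" "u y \<in> P (\<alpha> i)" using fuf u_im by auto
      then show "y \<in> f ` P (\<alpha> i)" by (metis imageI)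
    qed
    moreover have "|P i| =o |P (\<alpha> i)|" for i
      using u card_of_ordIso by blast
    moreover have "collapse (P (\<alpha> i)) f =o defect (P (\<alpha> i)) (P (?\<chi> (\<alpha> i))) f"
      if "i \<in> range ?\<chi>" for i
    proof -
      have "?\<chi> (\<alpha> i) = i" using that \<chi>\<alpha>\<chi> by auto
      then have "bij_betw u (P (?\<chi> (\<alpha> i))) (P (\<alpha> i))" using u by simp
      moreover have "\<forall>z \<in> f ` P (\<alpha> i). f (u z) = z" using fuf by auto
      ultimately show ?thesis
        using collapse_eq_defect_iff[OF f_im] by blast
    qed
    ultimately show "?\<chi> \<circ> \<alpha> \<circ> ?\<chi> = ?\<chi> \<and>
        (\<forall>i \<in> range ?\<chi>. P i \<inter> range f \<subseteq> f ` P (\<alpha> i)) \<and>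
        (\<forall>i. |P i| =o |P (\<alpha> i)| ) \<and>
        (\<forall>i \<in> range ?\<chi>. collapse (P (\<alpha> i)) f =o defect (P (\<alpha> i)) (P (?\<chi> (\<alpha> i))) f)"
      using \<chi>\<alpha>\<chi> by (simp add: fun_eq_iff)
  next
    fix \<alpha>
    assume conds: "?\<chi> \<circ> \<alpha> \<circ> ?\<chi> = ?\<chi> \<and>
        (\<forall>i \<in> range ?\<chi>. P i \<inter> range f \<subseteq> f ` P (\<alpha> i)) \<and>
        (\<forall>i. |P i| =o |P (\<alpha> i)| ) \<and>
        (\<forall>i \<in> range ?\<chi>. collapse (P (\<alpha> i)) f =o defect (P (\<alpha> i)) (P (?\<chi> (\<alpha> i))) f)"
    have "\<exists>g. bij_betw g (P i) (P (\<alpha> i)) \<and> (\<forall>y \<in> P i \<inter> range f. f (g y) = y)" for i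
    proof (cases "i \<in> range ?\<chi>")
      case True
      then have \<chi>\<alpha>: "?\<chi> (\<alpha> i) = i" using conds by (auto simp: fun_eq_iff)
      have "collapse (P (\<alpha> i)) f =o defect (P (\<alpha> i)) (P (?\<chi> (\<alpha> i))) f"
        using conds True by blast
      then obtain g where "bij_betw g (P i) (P (\<alpha> i))" "\<forall>z \<in> f ` P (\<alpha> i). f (g z) = z"
        using collapse_eq_defect_iff[OF f_im[of "\<alpha> i"]] \<chi>\<alpha> by auto
      moreover have "P i \<inter> range f \<subseteq> f ` P (\<alpha> i)" using conds True by blast
      ultimately show ?thesis by blast
    next
      case False
      have "P i \<inter> range f = {}"
      proof (rule ccontr)
        assume "P i \<inter> range f \<noteq> {}"
        then obtain x where "f x \<in> P i" by blast
        moreover obtain j where "x \<in> P j" using cover by blast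
        then have "f x \<in> P (?\<chi> j)" using f_im by blast
        ultimately have "i = ?\<chi> j" by (rule block_unique[OF P])
        then show False using False by blast
      qed
      moreover obtain g where "bij_betw g (P i) (P (\<alpha> i))"
        using conds card_of_ordIso by blast
      ultimately show ?thesis by blast
    qed
    then obtain g where g: "\<And>i. bij_betw (g i) (P i) (P (\<alpha> i))"
      and sec: "\<And>i y. y \<in> P i \<Longrightarrow> y \<in> range f \<Longrightarrow> f (g i y) = y"
      by (metis IntI)
    obtain b where b: "\<And>x. x \<in> P (b x)" using cover by metis
    \<comment> \<open>Gluing the bijections on the single blocks; \<open>b\<close> sends a point to the index of its block.\<close>
    define u where "u x = g (b x) x" for x
    have u_eq: "u x = g i x" if "x \<in> P i" for x i
      unfolding u_def using block_unique[OF P b that] by simp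
    have "bij_betw u (P i) (P (\<alpha> i))" for i
      using g by (rule bij_betw_cong[THEN iffD1, rotated]) (simp add: u_eq)
    moreover have "f \<circ> u \<circ> f = f"
      by (simp add: fun_eq_iff u_def sec b)
    ultimately show "\<exists>u. (\<forall>i. bij_betw u (P i) (P (\<alpha> i))) \<and> f \<circ> u \<circ> f = f" by blast
  qed
qed

end
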